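(* Let $A: X\to X$ be a linear operator, let $b\in X$, and let $F: X\to X$ be given by $F(x)=b-Ax$. Let $x_1,\dots,x_m\in X$ and $r_k=F(x_k)$ for $1\le k\le m$. Then the constrained reduced order method problem $$\min_{\alpha\in\mathbb{R}^m}\ \Big|F\Big(\sum_{k\le m}\alpha_k x_k\Big)\Big|^2\quad\text{subject to}\quad\sum_{k\le m}\alpha_k=1$$ is equivalent to the problem of minimizing the total residual $$\min_{\alpha\in\mathbb{R}^m}\ \Big|\sum_{k\le m}\alpha_k r_k\Big|^2\quad\text{subject to}\quad\sum_{k\le m}\alpha_k=1,$$ that is, the two problems have the same minimizers $\alpha$.
   Context: $X$ is a real Banach space whose norm $|\cdot|$ is induced by an inner product $(\cdot,\cdot)$. Here "linear residual" means that $F$ has the form $F(x)=b-Ax$ with $A$ linear. *)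

theory Defs
  imports "HOL-Analysis.Analysis"
begin

end

theory Submission
  imports Defs
begin

text \<open>
  A map of the form \<open>y \<mapsto> b - A y\<close> with \<open>A\<close> linear is affine, so it commutes with affine
  combinations: when the weights sum to one, the residual of the combined point is the combination
  of the residuals. Both objectives therefore agree at every feasible \<open>\<alpha>\<close>. As being a minimizer
  subject to a constraint only depends on the values of the objective on the feasible set, the two
  problems have the same minimizers.
\<close>

text \<open>
  The constraint enters by way of \<open>b = (\<Sum>k\<in>S. c k) *\<^sub>R b\<close>, which lets the constant term be
  distributed over the summands.
\<close>

lemma linear_residual_affine_combination:
  fixes A :: "'a::real_vector \<Rightarrow> 'b::real_vector"
  assumes "linear A" and "(\<Sum>k\<in>S. c k) = 1"
  shows "b - A (\<Sum>k\<in>S. c k *\<^sub>R x k) = (\<Sum>k\<in>S. c k *\<^sub>R (b - A (x k)))"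
proof -
  have "A (\<Sum>k\<in>S. c k *\<^sub>R x k) = (\<Sum>k\<in>S. c k *\<^sub>R A (x k))"
    using assms(1) by (simp add: linear_sum linear_scale)
  moreover have "(\<Sum>k\<in>S. c k *\<^sub>R b) = b"
    using assms(2) by (simp flip: scaleR_sum_left)
  ultimately show ?thesis
    by (simp add: scaleR_right_diff_distrib sum_subtractf)
qed

lemma is_arg_min_cong:
  assumes "\<And>y. P y \<Longrightarrow> f y = g y"
  shows "is_arg_min f P x \<longleftrightarrow> is_arg_min g P x"
  using assms unfolding is_arg_min_def by metis

theorem proposition4p3:
  fixes A :: "'a::{real_inner, banach} \<Rightarrow> 'a"
    and b :: 'a
    and F :: "'a \<Rightarrow> 'a"
    and x r :: "'m::finite \<Rightarrow> 'a"
  assumes "linear A"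
    and "\<And>y. F y = b - A y"
    and "\<And>k. r k = F (x k)"
  shows "{\<alpha> :: real ^ 'm.
            is_arg_min (\<lambda>\<alpha>. (norm (F (\<Sum>k\<in>UNIV. (\<alpha> $ k) *\<^sub>R x k)))\<^sup>2)
                       (\<lambda>\<alpha>. (\<Sum>k\<in>UNIV. \<alpha> $ k) = 1) \<alpha>}
       = {\<alpha> :: real ^ 'm.
            is_arg_min (\<lambda>\<alpha>. (norm (\<Sum>k\<in>UNIV. (\<alpha> $ k) *\<^sub>R r k))\<^sup>2)
                       (\<lambda>\<alpha>. (\<Sum>k\<in>UNIV. \<alpha> $ k) = 1) \<alpha>}"
proof -
  have "F (\<Sum>k\<in>UNIV. (\<alpha> $ k) *\<^sub>R x k) = (\<Sum>k\<in>UNIV. (\<alpha> $ k) *\<^sub>R r k)"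
    if "(\<Sum>k\<in>UNIV. \<alpha> $ k) = 1" for \<alpha> :: "real ^ 'm"
    using linear_residual_affine_combination[OF assms(1) that] by (simp add: assms(2,3))
  then show ?thesis
    by (intro Collect_cong is_arg_min_cong) simp
qed

end
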